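(* Let $n\ge 1$ be an integer. Suppose $f:X\to Y$ is a function of metric spaces that is bornologous with control $E$, coarsely $n$-to-1 with control $D$, and coarsely surjective. Then $Y$ is of countable asymptotic dimension if and only if $X$ is of countable asymptotic dimension.
   Context: A function $f:X\to Y$ of metric spaces is bornologous with control $E:[0,\infty)\to[0,\infty)$ if the image of every subset of $X$ of diameter at most $r$ has diameter at most $E(r)$. A bornologous function $f:X\to Y$ is coarsely $n$-to-1 with control $D:[0,\infty)\to[0,\infty)$ if for each subset $B$ of $Y$ with $\mathrm{diam}(B)\le r$ one has $f^{-1}(B)=\bigcup_{i=1}^n A_i$ for some subsets $A_i$ of $X$ with $\mathrm{diam}(A_i)<D(r)$ for $i=1,\dots,n$. For $A\subset Y$ and $R>0$, $B(A,R)$ consists of $A$ and all points at distance less than $R$ from some point of $A$. $f:X\to Y$ is coarsely surjective if $Y\subset B(f(X),R)$ for some $R>0$. A family of subsets of $X$ is uniformly bounded if the diameters of its members have a common finite upper bound. A family is $R$-disjoint if $d(x,y)\ge R$ whenever $x$ and $y$ belong to different elements of the family. A set $U$ is "expressed as a union of at most $k$ families from $\mathcal{V}$ that are $R$-disjoint" if there are at most $k$ subfamilies of $\mathcal{V}$, each $R$-disjoint, such that the union of all members of these subfamilies equals $U$. A metric space $X$ is of countable asymptotic dimension if there is a sequence of integers $n_i\ge 1$, $i\ge 1$, such that for any sequence of positive real numbers $R_i$, $i\ge 1$, there is a sequence $\mathcal{V}_i$, $i\ge 1$, of families of subsets of $X$ such that: 1. $\mathcal{V}_1=\{X\}$; 2.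 each element $U\in\mathcal{V}_i$ can be expressed as a union of at most $n_i$ families from $\mathcal{V}_{i+1}$ that are $R_i$-disjoint; 3. at least one of the families $\mathcal{V}_i$ is uniformly bounded. *)

theory Defs
  imports "HOL-Analysis.Analysis"
begin

text \<open>
  A metric space is a set \<open>X :: 'a::metric_space set\<close> with the restricted metric. This covers
  every metric space on a whole type (\<open>X = UNIV\<close>) and also the empty metric space.

  The library's \<^const>\<open>diameter\<close> is a real supremum and is meaningless on unbounded sets, so
  diameter bounds carry \<^const>\<open>bounded\<close> explicitly. The empty set has diameter \<open>0\<close>.
\<close>

definition diam_le :: "'a::metric_space set \<Rightarrow> real \<Rightarrow> bool" where
  "diam_le S r \<longleftrightarrow> bounded S \<and> diameter S \<le> r"

definition diam_less :: "'a::metric_space set \<Rightarrow> real \<Rightarrow> bool" where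
  "diam_less S r \<longleftrightarrow> bounded S \<and> diameter S < r"

text \<open>A function \<open>[0,\<infinity>) \<rightarrow> [0,\<infinity>)\<close>; values at negative arguments are never used.\<close>

definition control_function :: "(real \<Rightarrow> real) \<Rightarrow> bool" where
  "control_function E \<longleftrightarrow> (\<forall>r\<ge>0. 0 \<le> E r)"

definition bornologous_with ::
  "'a::metric_space set \<Rightarrow> ('a \<Rightarrow> 'b::metric_space) \<Rightarrow> (real \<Rightarrow> real) \<Rightarrow> bool" where
  "bornologous_with X f E \<longleftrightarrow>
     control_function E \<and>
     (\<forall>r\<ge>0. \<forall>S\<subseteq>X. diam_le S r \<longrightarrow> diam_le (f ` S) (E r))"

definition coarsely_n_to_1_with ::
  "nat \<Rightarrow> 'a::metric_space set \<Rightarrow> 'b::metric_space set \<Rightarrow> ('a \<Rightarrow> 'b) \<Rightarrow> (real \<Rightarrow> real) \<Rightarrow> bool" where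
  "coarsely_n_to_1_with n X Y f D \<longleftrightarrow>
     control_function D \<and>
     (\<forall>r\<ge>0. \<forall>B\<subseteq>Y. diam_le B r \<longrightarrow>
        (\<exists>A :: nat \<Rightarrow> 'a set.
           f -` B \<inter> X = (\<Union>i\<in>{1..n}. A i) \<and> (\<forall>i\<in>{1..n}. diam_less (A i) (D r))))"

definition metric_nbhd :: "'a::metric_space set \<Rightarrow> 'a set \<Rightarrow> real \<Rightarrow> 'a set" where
  "metric_nbhd Y A R = A \<union> {y \<in> Y. \<exists>a\<in>A. dist y a < R}"

definition coarsely_surjective ::
  "'a set \<Rightarrow> 'b::metric_space set \<Rightarrow> ('a \<Rightarrow> 'b) \<Rightarrow> bool" where
  "coarsely_surjective X Y f \<longleftrightarrow> (\<exists>R>0. Y \<subseteq> metric_nbhd Y (f ` X) R)"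

definition uniformly_bounded :: "'a::metric_space set set \<Rightarrow> bool" where
  "uniformly_bounded \<V> \<longleftrightarrow> (\<exists>b. \<forall>U\<in>\<V>. diam_le U b)"

definition R_disjoint :: "real \<Rightarrow> 'a::metric_space set set \<Rightarrow> bool" where
  "R_disjoint R \<F> \<longleftrightarrow> (\<forall>U\<in>\<F>. \<forall>V\<in>\<F>. U \<noteq> V \<longrightarrow> (\<forall>x\<in>U. \<forall>y\<in>V. R \<le> dist x y))"

definition union_of_R_disjoint_families ::
  "'a::metric_space set \<Rightarrow> nat \<Rightarrow> real \<Rightarrow> 'a set set \<Rightarrow> bool" where
  "union_of_R_disjoint_families U k R \<V> \<longleftrightarrow>
     (\<exists>\<S> :: 'a set set set. finite \<S> \<and> card \<S> \<le> k \<and>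
        (\<forall>\<F>\<in>\<S>. \<F> \<subseteq> \<V> \<and> R_disjoint R \<F>) \<and> U = (\<Union>\<F>\<in>\<S>. \<Union>\<F>))"

text \<open>Sequences are indexed by \<open>i \<ge> 1\<close>; their values at index \<open>0\<close> play no role.\<close>

definition countable_asymptotic_dimension :: "'a::metric_space set \<Rightarrow> bool" where
  "countable_asymptotic_dimension X \<longleftrightarrow>
     (\<exists>n :: nat \<Rightarrow> nat. (\<forall>i\<ge>1. 1 \<le> n i) \<and>
       (\<forall>R :: nat \<Rightarrow> real. (\<forall>i\<ge>1. 0 < R i) \<longrightarrow>
         (\<exists>\<V> :: nat \<Rightarrow> 'a set set.
            (\<forall>i\<ge>1. \<forall>U\<in>\<V> i. U \<subseteq> X) \<and>
            \<V> 1 = {X} \<and>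
            (\<forall>i\<ge>1. \<forall>U\<in>\<V> i. union_of_R_disjoint_families U (n i) (R i) (\<V> (i + 1))) \<and>
            (\<exists>i\<ge>1. uniformly_bounded (\<V> i)))))"

end

theory Submission
  imports Defs
begin

text \<open>
  From \<open>Y\<close> to \<open>X\<close>: pull the families back along \<open>f\<close>; once they are uniformly bounded in \<open>Y\<close>,
  one extra step cuts each preimage into its \<open>n\<close> bounded pieces.

  From \<open>X\<close> to \<open>Y\<close>: at level \<open>i\<close> take all sets lying in the \<open>r\<^sub>i\<close>-neighbourhood of \<open>f(U)\<close> for some
  \<open>U \<in> \<V>\<^sub>i\<close>. If \<open>\<F>\<close> is sufficiently disjoint in \<open>X\<close>, then a ball of radius \<open>r + n R\<close> in \<open>Y\<close> meets
  at most \<open>n\<close> of the sets \<open>f(V)\<close>, \<open>V \<in> \<F>\<close>. Let \<open>T\<^sub>j(a)\<close> be the set of those \<open>V \<in> \<F>\<close> with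
  \<open>dist(a, f(V)) < r + j R\<close>. In the chain \<open>T\<^sub>0(a) \<subseteq> \<dots> \<subseteq> T\<^sub>n(a)\<close> of nonempty sets with at most \<open>n\<close>
  elements two neighbours agree, and for fixed \<open>j\<close> the sets \<open>{a. T\<^sub>j(a) = T\<^sub>j\<^sub>+\<^sub>1(a) = T}\<close> form an
  \<open>R\<close>-disjoint family. Hence \<open>n\<close> families suffice for each \<open>\<F>\<close>.
\<close>

section \<open>Diameter bounds through distances of points\<close>

lemma diam_leI:
  assumes "0 \<le> r" and "\<And>x y. x \<in> S \<Longrightarrow> y \<in> S \<Longrightarrow> dist x y \<le> r"
  shows "diam_le S r"
proof (cases "S = {}")
  case True
  then show ?thesis using assms(1) by (simp add: diam_le_def)
next
  case False
  then have "diameter S \<le> r"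
    using assms(2) by (auto simp: diameter_def intro!: cSUP_least)
  moreover have "bounded S"
    using assms(2) unfolding bounded_two_points by blast
  ultimately show ?thesis by (simp add: diam_le_def)
qed

lemma diam_leD: "diam_le S r \<Longrightarrow> x \<in> S \<Longrightarrow> y \<in> S \<Longrightarrow> dist x y \<le> r"
  unfolding diam_le_def using diameter_bounded_bound by fastforce

lemma diam_lessD: "diam_less S r \<Longrightarrow> x \<in> S \<Longrightarrow> y \<in> S \<Longrightarrow> dist x y < r"
  unfolding diam_less_def using diameter_bounded_bound by fastforce

lemma diam_le_mono: "diam_le S r \<Longrightarrow> r \<le> s \<Longrightarrow> diam_le S s"
  by (auto simp: diam_le_def)

text \<open>A negative bound is possible only for the empty family. It has to be excluded because
  the controls \<open>E\<close> and \<open>D\<close> constrain nothing at negative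
  arguments.\<close>

lemma uniformly_bounded_nonneg:
  assumes "uniformly_bounded \<V>"
  obtains b where "0 \<le> b" and "\<And>U. U \<in> \<V> \<Longrightarrow> diam_le U b"
  using assms unfolding uniformly_bounded_def
  by (metis diam_le_mono linorder_le_cases)

lemma bornologous_dist_le:
  assumes "bornologous_with X f E" and "x \<in> X" "y \<in> X" "0 \<le> r" "dist x y \<le> r"
  shows "dist (f x) (f y) \<le> E r"
proof -
  have "diam_le {x, y} r"
    using assms by (intro diam_leI) (auto simp: dist_commute)
  moreover have "{x, y} \<subseteq> X" using assms by simp
  ultimately have "diam_le (f ` {x, y}) (E r)"
    using assms(1) \<open>0 \<le> r\<close> unfolding bornologous_with_def by (simp del: image_insert)
  then show ?thesis by (rule diam_leD) auto
qed

section \<open>Preimages of disjoint families\<close>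

text \<open>Points closer than \<open>R\<close> have images at distance at most \<open>E R\<close>,
  which is less than \<open>S\<close>, so these images cannot lie in two different members of
  \<open>\<F>\<close>.\<close>

lemma R_disjoint_vimage:
  assumes "bornologous_with X f E" "0 < R" "E R < S" "R_disjoint S \<F>"
  shows "R_disjoint R ((\<lambda>U. f -` U \<inter> X) ` \<F>)"
  unfolding R_disjoint_def
proof (intro ballI impI)
  fix P Q x y
  assume "P \<in> (\<lambda>U. f -` U \<inter> X) ` \<F>" "Q \<in> (\<lambda>U. f -` U \<inter> X) ` \<F>"
    and ne: "P \<noteq> Q" and x: "x \<in> P" and y: "y \<in> Q"
  then obtain U V where UV: "U \<in> \<F>" "V \<in> \<F>" "P = f -` U \<inter> X" "Q = f -` V \<inter> X"
    by (elim imageE)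
  have "U \<noteq> V" "f x \<in> U" "f y \<in> V" using UV ne x y by auto
  then have "S \<le> dist (f x) (f y)"
    using assms(4) UV(1,2) unfolding R_disjoint_def by blast
  moreover have "dist (f x) (f y) \<le> E R" if "dist x y < R"
    using that assms(2) UV(3,4) x y by (intro bornologous_dist_le[OF assms(1)]) auto
  ultimately show "R \<le> dist x y"
    using assms(3) by (cases "dist x y < R") auto
qed

lemma union_of_R_disjoint_families_vimage:
  assumes "bornologous_with X f E" "0 < R" "E R < S"
    and "union_of_R_disjoint_families U k S \<V>"
  shows "union_of_R_disjoint_families (f -` U \<inter> X) k R ((\<lambda>U. f -` U \<inter> X) ` \<V>)"
proof -
  obtain \<S> where \<S>: "finite \<S>" "card \<S> \<le> k" "\<And>\<F>. \<F> \<in> \<S> \<Longrightarrow> \<F> \<subseteq> \<V> \<and> R_disjoint S \<F>"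
    and U: "U = (\<Union>\<F>\<in>\<S>. \<Union>\<F>)"
    using assms(4) unfolding union_of_R_disjoint_families_def by blast
  let ?g = "\<lambda>U. f -` U \<inter> X"
  have "finite ((`) ?g ` \<S>)" "card ((`) ?g ` \<S>) \<le> k"
    using \<S>(1,2) card_image_le[of \<S> "(`) ?g"] by simp_all
  moreover have "\<forall>\<G>\<in>(`) ?g ` \<S>. \<G> \<subseteq> ?g ` \<V> \<and> R_disjoint R \<G>"
    using \<S>(3) R_disjoint_vimage[OF assms(1-3)] by blast
  moreover have "?g U = (\<Union>\<G>\<in>(`) ?g ` \<S>. \<Union>\<G>)"
    by (simp add: U vimage_UN vimage_Union image_image)
  ultimately show ?thesis
    unfolding union_of_R_disjoint_families_def
    by (intro exI[of _ "(`) ?g ` \<S>"] conjI)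
qed

lemma union_of_R_disjoint_families_mono:
  assumes "union_of_R_disjoint_families U k R \<V>" "k \<le> l"
  shows "union_of_R_disjoint_families U l R \<V>"
  using assms unfolding union_of_R_disjoint_families_def
  by (elim exE conjE, intro exI conjI) (assumption | rule le_trans)+

lemma R_disjoint_singleton: "R_disjoint R {A}"
  by (simp add: R_disjoint_def)

text \<open>A family with one member is \<open>R\<close>-disjoint for every \<open>R\<close>. Hence
  a cover by \<open>n\<close> sets counts as \<open>n\<close> families without any separation
  between the sets.\<close>

lemma union_of_singleton_families:
  assumes "U = (\<Union>i\<in>{1..n}. A i)" and "\<And>i. i \<in> {1..n} \<Longrightarrow> A i \<in> \<V>"
  shows "union_of_R_disjoint_families U n R \<V>"
  unfolding union_of_R_disjoint_families_def
proof (intro exI[of _ "(\<lambda>i. {A i}) ` {1..n}"] conjI ballI)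
  show "card ((\<lambda>i. {A i}) ` {1..n}) \<le> n"
    using card_image_le[of "{1..n}" "\<lambda>i. {A i}"] by simp
  fix \<F> assume "\<F> \<in> (\<lambda>i. {A i}) ` {1..n}"
  then obtain i where "i \<in> {1..n}" "\<F> = {A i}" by blast
  then show "\<F> \<subseteq> \<V>" "R_disjoint R \<F>"
    using assms(2) by (simp_all add: R_disjoint_singleton)
qed (simp_all add: assms(1))

text \<open>What remains of the dimension condition once \<open>N\<close> and \<open>R\<close> are
  fixed. Each direction of the theorem turns such a chain on one space into one on the
  other.\<close>

definition decomposition_chain ::
  "'a::metric_space set \<Rightarrow> (nat \<Rightarrow> nat) \<Rightarrow> (nat \<Rightarrow> real) \<Rightarrow> (nat \<Rightarrow> 'a set set) \<Rightarrow> bool" where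
  "decomposition_chain X N R \<V> \<longleftrightarrow>
     (\<forall>i\<ge>1. \<forall>U\<in>\<V> i. U \<subseteq> X) \<and>
     \<V> 1 = {X} \<and>
     (\<forall>i\<ge>1. \<forall>U\<in>\<V> i. union_of_R_disjoint_families U (N i) (R i) (\<V> (i + 1))) \<and>
     (\<exists>i\<ge>1. uniformly_bounded (\<V> i))"

lemma countable_asymptotic_dimension_iff_chain:
  "countable_asymptotic_dimension X \<longleftrightarrow>
     (\<exists>N. (\<forall>i\<ge>1. 1 \<le> N i) \<and>
       (\<forall>R. (\<forall>i\<ge>1. 0 < R i) \<longrightarrow> (\<exists>\<V>. decomposition_chain X N R \<V>)))"
  unfolding countable_asymptotic_dimension_def decomposition_chain_def by (rule refl)

lemma decomposition_chainE:
  assumes "decomposition_chain X N R \<V>"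
  obtains m where "\<And>i U. i \<ge> 1 \<Longrightarrow> U \<in> \<V> i \<Longrightarrow> U \<subseteq> X" and "\<V> 1 = {X}"
    and "\<And>i U. i \<ge> 1 \<Longrightarrow> U \<in> \<V> i \<Longrightarrow>
      union_of_R_disjoint_families U (N i) (R i) (\<V> (i + 1))"
    and "m \<ge> 1" "uniformly_bounded (\<V> m)"
proof -
  obtain m where "m \<ge> 1" "uniformly_bounded (\<V> m)"
    using assms unfolding decomposition_chain_def by (elim conjE exE)
  then show thesis
    using assms unfolding decomposition_chain_def by (intro that[of m]) simp_all
qed

lemma decomposition_chainI:
  assumes "\<And>i U. i \<ge> 1 \<Longrightarrow> U \<in> \<V> i \<Longrightarrow> U \<subseteq> X" "\<V> 1 = {X}"
    and "\<And>i U. i \<ge> 1 \<Longrightarrow> U \<in> \<V> i \<Longrightarrow>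
      union_of_R_disjoint_families U (N i) (R i) (\<V> (i + 1))"
    and "m \<ge> 1" "uniformly_bounded (\<V> m)"
  shows "decomposition_chain X N R \<V>"
  unfolding decomposition_chain_def using assms by (intro conjI exI[of _ m]) simp_all

section \<open>From \<open>Y\<close> to \<open>X\<close>\<close>

text \<open>The numbers of families have to be fixed before \<open>R\<close>, whereas the level
  \<open>m\<close> at which the chain on \<open>Y\<close> becomes bounded depends on
  \<open>R\<close>. The cut into \<open>n\<close> pieces may thus fall on any level, which explains
  \<open>max (N i) n\<close> at all of them.\<close>

lemma countable_asymptotic_dimension_vimage:
  assumes n: "n \<ge> 1"
    and f: "f \<in> X \<rightarrow> Y"
    and E: "bornologous_with X f E"
    and D: "coarsely_n_to_1_with n X Y f D"
    and Y: "countable_asymptotic_dimension Y"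
  shows "countable_asymptotic_dimension X"
proof -
  let ?g = "\<lambda>U. f -` U \<inter> X"
  obtain N where N: "\<And>i. i \<ge> 1 \<Longrightarrow> 1 \<le> N i"
    and ex: "\<And>R. (\<forall>i\<ge>1. 0 < R i) \<Longrightarrow> \<exists>\<V>. decomposition_chain Y N R \<V>"
    using Y unfolding countable_asymptotic_dimension_iff_chain by blast
  show ?thesis
    unfolding countable_asymptotic_dimension_iff_chain
  proof (intro exI[of _ "\<lambda>i. max (N i) n"] conjI allI impI)
    fix i :: nat assume "1 \<le> i"
    then show "1 \<le> max (N i) n" using n by simp
  next
    fix R :: "nat \<Rightarrow> real" assume R: "\<forall>i\<ge>1. 0 < R i"
    \<comment> \<open>The summand 1 makes the number positive and gives the strict inequality
      \<open>E (R i) < E (R i) + 1\<close> that pulling back needs.\<close>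
    have "\<forall>i\<ge>1. 0 < E (R i) + 1"
      using E R unfolding bornologous_with_def control_function_def
      by (meson add_nonneg_pos less_imp_le zero_less_one)
    from ex[OF this] obtain \<V> where "decomposition_chain Y N (\<lambda>i. E (R i) + 1) \<V>" by blast
    then obtain m where sub: "\<And>i U. i \<ge> 1 \<Longrightarrow> U \<in> \<V> i \<Longrightarrow> U \<subseteq> Y"
      and V1: "\<V> 1 = {Y}"
      and dec: "\<And>i U. i \<ge> 1 \<Longrightarrow> U \<in> \<V> i \<Longrightarrow>
        union_of_R_disjoint_families U (N i) (E (R i) + 1) (\<V> (i + 1))"
      and m: "m \<ge> 1" "uniformly_bounded (\<V> m)"
      by (rule decomposition_chainE) blast
    obtain b where b: "0 \<le> b" "\<And>U. U \<in> \<V> m \<Longrightarrow> diam_le U b"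
      using uniformly_bounded_nonneg[OF m(2)] by blast
    \<comment> \<open>\<open>P\<close> takes over at every level beyond \<open>m\<close>. The pieces
      of the preimages from level \<open>m\<close> lie in it, and later each member is decomposed
      into itself alone.\<close>
    define P where "P = {A. A \<subseteq> X \<and> diam_le A (D b)}"
    define \<W> where "\<W> i = (if i \<le> m then ?g ` \<V> i else P)" for i
    have "U \<subseteq> X" if "U \<in> \<W> i" for i U
      using that by (auto simp: \<W>_def P_def split: if_splits)
    moreover have "\<W> 1 = {X}"
      using m(1) V1 f by (auto simp: \<W>_def)
    moreover have "union_of_R_disjoint_families U (max (N i) n) (R i) (\<W> (i + 1))"
      if i: "i \<ge> 1" and U: "U \<in> \<W> i" for i U
    proof -
      consider "i < m" | "i = m" | "i > m" by linarith
      then show ?thesis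
      proof cases
        case 1
        then obtain V where V: "V \<in> \<V> i" "U = ?g V"
          using U by (auto simp: \<W>_def)
        then have "union_of_R_disjoint_families U (N i) (R i) (?g ` \<V> (i + 1))"
          using union_of_R_disjoint_families_vimage[OF E _ _ dec[OF i V(1)], of "R i"] R i
          by simp
        then show ?thesis
          using 1 by (auto simp: \<W>_def intro: union_of_R_disjoint_families_mono)
      next
        case 2
        then obtain V where V: "V \<in> \<V> m" "U = ?g V"
          using U by (auto simp: \<W>_def)
        obtain A where A: "?g V = (\<Union>i\<in>{1..n}. A i)"
          "\<And>i. i \<in> {1..n} \<Longrightarrow> diam_less (A i) (D b)"
          using D b(1) b(2)[OF V(1)] sub[OF m(1) V(1)]
          unfolding coarsely_n_to_1_with_def by meson
        have "A j \<in> P" if "j \<in> {1..n}" for j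
        proof -
          have "A j \<subseteq> X" using A(1) that by blast
          then show ?thesis
            using A(2)[OF that] by (simp add: P_def diam_le_def diam_less_def)
        qed
        then have "union_of_R_disjoint_families U n (R i) P"
          using union_of_singleton_families A(1) V(2) by metis
        then show ?thesis
          using 2 by (auto simp: \<W>_def intro: union_of_R_disjoint_families_mono)
      next
        case 3
        then have "U \<in> P" using U by (simp add: \<W>_def)
        then have "union_of_R_disjoint_families U 1 (R i) P"
          by (intro union_of_singleton_families[of _ "\<lambda>_. U"]) auto
        then show ?thesis
          using 3 n by (auto simp: \<W>_def intro: union_of_R_disjoint_families_mono)
      qed
    qed
    moreover have "uniformly_bounded (\<W> (m + 1))"
      by (auto simp: \<W>_def P_def uniformly_bounded_def)
    ultimately show "\<exists>\<V>. decomposition_chain X (\<lambda>i. max (N i) n) R \<V>"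
      by (intro exI[of _ \<W>] decomposition_chainI[of \<W> _ _ _ "m + 1"]) simp_all
  qed
qed

section \<open>Members of a family with image near a point\<close>

text \<open>The first set has an element, and each of the \<open>n\<close> strict inclusions adds
  another.\<close>

lemma less_card_of_strict_chain:
  fixes T :: "nat \<Rightarrow> 'c set"
  assumes "finite (T n)" "T 0 \<noteq> {}" "\<And>j. j < n \<Longrightarrow> T j \<subset> T (Suc j)"
  shows "n < card (T n)"
  using assms
proof (induction n)
  case 0
  then show ?case by (simp add: card_gt_0_iff)
next
  case (Suc n)
  then have "T n \<subset> T (Suc n)" by blast
  with Suc.prems(1) have "card (T n) < card (T (Suc n))" "finite (T n)"
    by (auto intro: psubset_card_mono finite_subset)
  moreover have "n < card (T n)"
    using Suc.IH[OF \<open>finite (T n)\<close> Suc.prems(2)] Suc.prems(3) by simp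
  ultimately show ?case by simp
qed

text \<open>With \<open>\<rho> = r + j * R\<close> this is the set T_j(a) of the overview.\<close>

definition near_members ::
  "('a \<Rightarrow> 'b::metric_space) \<Rightarrow> 'a set set \<Rightarrow> real \<Rightarrow> 'b \<Rightarrow> 'a set set" where
  "near_members f \<F> \<rho> a = {V \<in> \<F>. \<exists>v\<in>V. dist a (f v) < \<rho>}"

lemma near_members_mono: "\<rho> \<le> \<sigma> \<Longrightarrow> near_members f \<F> \<rho> a \<subseteq> near_members f \<F> \<sigma> a"
  unfolding near_members_def by force

text \<open>By the triangle inequality, enlarging the radius by \<open>R\<close> makes up for moving
  the centre by less than \<open>R\<close>.\<close>

lemma near_members_shift:
  assumes "dist a b < R"
  shows "near_members f \<F> \<rho> a \<subseteq> near_members f \<F> (\<rho> + R) b"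
proof
  fix V assume "V \<in> near_members f \<F> \<rho> a"
  then obtain v where "V \<in> \<F>" "v \<in> V" "dist a (f v) < \<rho>"
    by (auto simp: near_members_def)
  moreover from this have "dist b (f v) < \<rho> + R"
    using assms dist_triangle[of b "f v" a] by (simp add: dist_commute)
  ultimately show "V \<in> near_members f \<F> (\<rho> + R) b"
    by (auto simp: near_members_def)
qed

text \<open>The preimage of the ball of radius \<open>\<rho>\<close> around \<open>a\<close> splits
  into \<open>n\<close> pieces of diameter less than \<open>D (2 * \<rho>)\<close>. Every member
  counted here meets a piece, and since different members are at least \<open>S\<close> apart, no
  piece meets two of them.\<close>

lemma near_members_card:
  assumes f: "f \<in> X \<rightarrow> Y"
    and D: "coarsely_n_to_1_with n X Y f D"
    and \<F>: "\<And>V. V \<in> \<F> \<Longrightarrow> V \<subseteq> X" "R_disjoint S \<F>"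
    and S: "0 \<le> \<rho>" "D (2 * \<rho>) \<le> S"
  shows "finite (near_members f \<F> \<rho> a) \<and> card (near_members f \<F> \<rho> a) \<le> n"
proof -
  let ?T = "near_members f \<F> \<rho> a"
  let ?B = "ball a \<rho> \<inter> Y"
  have "diam_le ?B (2 * \<rho>)"
  proof (rule diam_leI)
    fix x y assume "x \<in> ?B" "y \<in> ?B"
    then show "dist x y \<le> 2 * \<rho>"
      using dist_triangle[of x y a] by (simp add: dist_commute)
  qed (use S in simp)
  then obtain A where A: "f -` ?B \<inter> X = (\<Union>i\<in>{1..n}. A i)"
    "\<And>i. i \<in> {1..n} \<Longrightarrow> diam_less (A i) (D (2 * \<rho>))"
    using D S(1) unfolding coarsely_n_to_1_with_def
    by (metis inf_le2 mult_nonneg_nonneg zero_le_numeral)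
  have "\<exists>i\<in>{1..n}. V \<inter> A i \<noteq> {}" if V: "V \<in> ?T" for V
  proof -
    obtain v where v: "V \<in> \<F>" "v \<in> V" "dist a (f v) < \<rho>"
      using V by (auto simp: near_members_def)
    then have "v \<in> f -` ?B \<inter> X" using \<F>(1) f by auto
    then show ?thesis using A(1) v(2) by blast
  qed
  then obtain c where c: "\<And>V. V \<in> ?T \<Longrightarrow> c V \<in> {1..n} \<and> V \<inter> A (c V) \<noteq> {}"
    by metis
  have "inj_on c ?T"
  proof (rule inj_onI, rule ccontr)
    fix V W assume VW: "V \<in> ?T" "W \<in> ?T" "c V = c W" "V \<noteq> W"
    obtain x y where xy: "x \<in> V" "x \<in> A (c V)" "y \<in> W" "y \<in> A (c V)"
      using c[OF VW(1)] c[OF VW(2)] VW(3) by auto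
    then have "S \<le> dist x y"
      using \<F>(2) VW unfolding R_disjoint_def near_members_def by blast
    moreover have "dist x y < D (2 * \<rho>)"
      using diam_lessD A(2) c[OF VW(1)] xy by blast
    ultimately show False using S(2) by linarith
  qed
  moreover have "c ` ?T \<subseteq> {1..n}" using c by blast
  ultimately show ?thesis
    using inj_on_finite[of c ?T "{1..n}"] card_inj_on_le[of c ?T "{1..n}"] by simp
qed

section \<open>Pieces on which the near members are constant\<close>

text \<open>A piece with \<open>T = {}\<close> would be near the image of no member of
  \<open>\<F>\<close>, so this value is excluded. Values \<open>T\<close> that are not attained give
  the empty piece.\<close>

definition stable_pieces ::
  "('a \<Rightarrow> 'b::metric_space) \<Rightarrow> 'a set set \<Rightarrow> real \<Rightarrow> real \<Rightarrow> 'b set \<Rightarrow> 'b set set" where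
  "stable_pieces f \<F> \<rho> R A =
     (\<lambda>T. {a \<in> A. near_members f \<F> \<rho> a = T \<and> near_members f \<F> (\<rho> + R) a = T}) ` (- {{}})"

lemma R_disjoint_stable_pieces: "R_disjoint R (stable_pieces f \<F> \<rho> R A)"
  unfolding R_disjoint_def
proof (intro ballI impI, rule ccontr)
  fix P Q a b
  assume "P \<in> stable_pieces f \<F> \<rho> R A" "Q \<in> stable_pieces f \<F> \<rho> R A"
    and ne: "P \<noteq> Q" and ab: "a \<in> P" "b \<in> Q" and "\<not> R \<le> dist a b"
  then obtain T T' where
    P: "P = {a \<in> A. near_members f \<F> \<rho> a = T \<and> near_members f \<F> (\<rho> + R) a = T}" and
    Q: "Q = {a \<in> A. near_members f \<F> \<rho> a = T' \<and> near_members f \<F> (\<rho> + R) a = T'}"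
    unfolding stable_pieces_def by blast
  have "dist a b < R" "dist b a < R"
    using \<open>\<not> R \<le> dist a b\<close> by (simp_all add: dist_commute)
  \<comment> \<open>The near members of \<open>a\<close> at radius \<open>\<rho>\<close>, which form
    \<open>T\<close>, are near members of \<open>b\<close> at radius \<open>\<rho> + R\<close>, and
    by stability these form \<open>T'\<close>. Then the roles are exchanged.\<close>
  then have "T \<subseteq> T'" "T' \<subseteq> T"
    using near_members_shift[of a b R f \<F> \<rho>] near_members_shift[of b a R f \<F> \<rho>] ab P Q
    by auto
  then show False using ne P Q by simp
qed

text \<open>Any \<open>V\<close> in the common value \<open>T\<close> is near all points of
  \<open>P\<close> at once. With \<open>P \<noteq> {}\<close> the value \<open>T\<close> is attained
  at a point and so consists of members of \<open>\<F>\<close>.\<close>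

lemma stable_pieces_subset:
  assumes "P \<in> stable_pieces f \<F> \<rho> R A"
  shows "P \<subseteq> A" and "P \<noteq> {} \<Longrightarrow> \<exists>V\<in>\<F>. \<forall>a\<in>P. \<exists>v\<in>V. dist a (f v) < \<rho>"
proof -
  obtain T where P: "P = {a \<in> A. near_members f \<F> \<rho> a = T \<and> near_members f \<F> (\<rho> + R) a = T}"
    and T: "T \<noteq> {}"
    using assms unfolding stable_pieces_def by blast
  show "P \<subseteq> A" using P by blast
  assume "P \<noteq> {}"
  obtain V where V: "V \<in> T" using T by blast
  have "V \<in> near_members f \<F> \<rho> a" if "a \<in> P" for a
    using that V P by blast
  then show "\<exists>V\<in>\<F>. \<forall>a\<in>P. \<exists>v\<in>V. dist a (f v) < \<rho>"
    using \<open>P \<noteq> {}\<close> unfolding near_members_def by blast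
qed

lemma stable_pieces_cover:
  assumes a: "a \<in> A" "near_members f \<F> r a \<noteq> {}" and R: "0 < R"
    and fin: "finite (near_members f \<F> (r + real n * R) a)"
    and card: "card (near_members f \<F> (r + real n * R) a) \<le> n"
  shows "\<exists>j<n. a \<in> \<Union>(stable_pieces f \<F> (r + real j * R) R A)"
proof -
  define T where "T j = near_members f \<F> (r + real j * R) a" for j
  have mono: "T j \<subseteq> T (Suc j)" for j
    unfolding T_def using R by (intro near_members_mono) (simp add: algebra_simps)
  have "\<exists>j<n. T j = T (Suc j)"
  proof (rule ccontr)
    assume "\<not> ?thesis"
    then have "n < card (T n)"
      using mono fin a(2) by (intro less_card_of_strict_chain) (auto simp: T_def)
    then show False using card by (simp add: T_def)
  qed
  then obtain j where j: "j < n" "T j = T (Suc j)" by blast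
  \<comment> \<open>The value \<open>T j\<close> must be nonempty to define a stable piece, and it
    inherits this from \<open>T 0\<close>.\<close>
  have "T 0 \<subseteq> T j"
    by (rule lift_Suc_mono_le[of T, OF mono]) simp
  then have "T j \<noteq> {}" using a(2) by (auto simp: T_def)
  moreover have "near_members f \<F> (r + real j * R + R) a = T j"
    using j(2) by (simp add: T_def algebra_simps)
  ultimately have "a \<in> \<Union>(stable_pieces f \<F> (r + real j * R) R A)"
    unfolding stable_pieces_def by (intro UN_I[of "T j"]) (use a(1) in \<open>simp_all add: T_def\<close>)
  with j(1) show ?thesis by (intro exI conjI)
qed

section \<open>From \<open>X\<close> to \<open>Y\<close>\<close>

definition image_nbhd_sets ::
  "('a \<Rightarrow> 'b::metric_space) \<Rightarrow> 'b set \<Rightarrow> 'a set set \<Rightarrow> real \<Rightarrow> 'b set set" where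
  "image_nbhd_sets f Y \<V> r = {A. A \<subseteq> Y \<and> (\<exists>U\<in>\<V>. \<forall>a\<in>A. \<exists>u\<in>U. dist a (f u) < r)}"

text \<open>Each pair of a family \<open>\<F>\<close> and a stage \<open>j < n\<close> yields one
  family of stable pieces, hence \<open>k * n\<close>. Pieces of stage \<open>j\<close> stay within
  \<open>r + j * R\<close> of an image, which \<open>r + n * R\<close> bounds. The latter is also
  the radius at which near members are counted, whence the argument of \<open>D\<close>.\<close>

lemma union_of_R_disjoint_families_image_nbhd_sets:
  assumes f: "f \<in> X \<rightarrow> Y"
    and D: "coarsely_n_to_1_with n X Y f D"
    and \<V>: "\<And>V. V \<in> \<V> \<Longrightarrow> V \<subseteq> X"
    and U: "union_of_R_disjoint_families U k S \<V>"
    and A: "A \<subseteq> Y" "\<And>a. a \<in> A \<Longrightarrow> \<exists>u\<in>U. dist a (f u) < r"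
    and R: "0 \<le> r" "0 < R" "D (2 * (r + real n * R)) \<le> S"
  shows "union_of_R_disjoint_families A (k * n) R (image_nbhd_sets f Y \<V> (r + real n * R))"
proof -
  obtain \<S> where \<S>: "finite \<S>" "card \<S> \<le> k" "\<And>\<F>. \<F> \<in> \<S> \<Longrightarrow> \<F> \<subseteq> \<V> \<and> R_disjoint S \<F>"
    and U_eq: "U = (\<Union>\<F>\<in>\<S>. \<Union>\<F>)"
    using U unfolding union_of_R_disjoint_families_def by blast
  \<comment> \<open>The empty set is removed since it lies in
    \<open>image_nbhd_sets f Y \<V> _\<close> only when \<open>\<V>\<close> has a member.\<close>
  define G where "G = (\<lambda>(\<F>, j). stable_pieces f \<F> (r + real j * R) R A - {{}})"
  let ?\<T> = "G ` (\<S> \<times> {..<n})"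
  have "card ?\<T> \<le> card (\<S> \<times> {..<n})"
    using \<S>(1) by (intro card_image_le) simp
  also have "\<dots> \<le> k * n"
    using \<S>(2) by (simp add: card_cartesian_product)
  finally have card: "card ?\<T> \<le> k * n" .
  have fam: "G (\<F>, j) \<subseteq> image_nbhd_sets f Y \<V> (r + real n * R) \<and> R_disjoint R (G (\<F>, j))"
    if "\<F> \<in> \<S>" "j < n" for \<F> j
  proof
    show "R_disjoint R (G (\<F>, j))"
      using R_disjoint_stable_pieces[of R f \<F> "r + real j * R" A]
      unfolding G_def R_disjoint_def by auto
    show "G (\<F>, j) \<subseteq> image_nbhd_sets f Y \<V> (r + real n * R)"
    proof
      fix P assume "P \<in> G (\<F>, j)"
      then have P: "P \<in> stable_pieces f \<F> (r + real j * R) R A" "P \<noteq> {}"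
        by (auto simp: G_def)
      obtain V where V: "V \<in> \<F>" "\<And>a. a \<in> P \<Longrightarrow> \<exists>v\<in>V. dist a (f v) < r + real j * R"
        using stable_pieces_subset(2)[OF P] by blast
      have "r + real j * R \<le> r + real n * R"
        using that(2) R(2) by simp
      then have "\<forall>a\<in>P. \<exists>v\<in>V. dist a (f v) < r + real n * R"
        using V(2) by (meson less_le_trans)
      moreover have "P \<subseteq> Y" using stable_pieces_subset(1)[OF P(1)] A(1) by blast
      ultimately show "P \<in> image_nbhd_sets f Y \<V> (r + real n * R)"
        using V(1) \<S>(3)[OF that(1)] unfolding image_nbhd_sets_def by blast
    qed
  qed
  have "A = (\<Union>\<G>\<in>?\<T>. \<Union>\<G>)"
  proof
    show "(\<Union>\<G>\<in>?\<T>. \<Union>\<G>) \<subseteq> A"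
      using stable_pieces_subset(1) unfolding G_def by fastforce
    show "A \<subseteq> (\<Union>\<G>\<in>?\<T>. \<Union>\<G>)"
    proof
      fix a assume a: "a \<in> A"
      obtain u where u: "u \<in> U" "dist a (f u) < r" using A(2)[OF a] by blast
      then obtain \<F> V where \<F>: "\<F> \<in> \<S>" "V \<in> \<F>" "u \<in> V" using U_eq by blast
      have ne: "near_members f \<F> r a \<noteq> {}"
        using \<F> u unfolding near_members_def by blast
      have card: "finite (near_members f \<F> (r + real n * R) a) \<and>
          card (near_members f \<F> (r + real n * R) a) \<le> n"
        using \<S>(3)[OF \<F>(1)] \<V> R by (intro near_members_card[OF f D]) auto
      obtain j where j: "j < n" "a \<in> \<Union>(stable_pieces f \<F> (r + real j * R) R A)"
        using stable_pieces_cover[OF a ne R(2) conjunct1[OF card] conjunct2[OF card]]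
        by (elim exE conjE)
      then have "a \<in> \<Union>(G (\<F>, j))" by (auto simp: G_def)
      moreover have "G (\<F>, j) \<in> ?\<T>" using \<F>(1) j(1) by (intro imageI) simp
      ultimately show "a \<in> (\<Union>\<G>\<in>?\<T>. \<Union>\<G>)" by (intro UN_I)
    qed
  qed
  then show ?thesis
    unfolding union_of_R_disjoint_families_def
    using \<S>(1) card fam by (intro exI[of _ ?\<T>] conjI) auto
qed

text \<open>Two points of one set lie within \<open>r\<close> of images of points of a single
  \<open>U\<close>, and these images are at most \<open>E b\<close> apart.\<close>

lemma uniformly_bounded_image_nbhd_sets:
  assumes E: "bornologous_with X f E"
    and \<V>: "\<And>V. V \<in> \<V> \<Longrightarrow> V \<subseteq> X" "uniformly_bounded \<V>" and r: "0 \<le> r"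
  shows "uniformly_bounded (image_nbhd_sets f Y \<V> r)"
proof -
  obtain b where b: "0 \<le> b" "\<And>U. U \<in> \<V> \<Longrightarrow> diam_le U b"
    using uniformly_bounded_nonneg[OF \<V>(2)] by blast
  have "diam_le A (E b + 2 * r)" if A: "A \<in> image_nbhd_sets f Y \<V> r" for A
  proof (rule diam_leI)
    show "0 \<le> E b + 2 * r"
      using E b(1) r unfolding bornologous_with_def control_function_def by simp
    fix x y assume xy: "x \<in> A" "y \<in> A"
    obtain U where U: "U \<in> \<V>" "\<And>a. a \<in> A \<Longrightarrow> \<exists>u\<in>U. dist a (f u) < r"
      using A unfolding image_nbhd_sets_def by blast
    obtain u v where uv: "u \<in> U" "v \<in> U" "dist x (f u) < r" "dist y (f v) < r"
      using U(2) xy by meson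
    have "dist (f u) (f v) \<le> E b"
      using uv \<V>(1)[OF U(1)] b diam_leD[OF b(2)[OF U(1)]]
      by (intro bornologous_dist_le[OF E]) auto
    then show "dist x y \<le> E b + 2 * r"
      using uv dist_triangle[of x y "f u"] dist_triangle[of "f u" y "f v"]
      by (simp add: dist_commute)
  qed
  then show ?thesis unfolding uniformly_bounded_def by blast
qed

lemma uniformly_bounded_subset:
  "uniformly_bounded \<W> \<Longrightarrow> \<V> \<subseteq> \<W> \<Longrightarrow> uniformly_bounded \<V>"
  unfolding uniformly_bounded_def by blast

lemma countable_asymptotic_dimension_coarse_image:
  assumes n: "n \<ge> 1"
    and f: "f \<in> X \<rightarrow> Y"
    and E: "bornologous_with X f E"
    and D: "coarsely_n_to_1_with n X Y f D"
    and surj: "coarsely_surjective X Y f"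
    and X: "countable_asymptotic_dimension X"
  shows "countable_asymptotic_dimension Y"
proof -
  obtain N where N: "\<And>i. i \<ge> 1 \<Longrightarrow> 1 \<le> N i"
    and ex: "\<And>R. (\<forall>i\<ge>1. 0 < R i) \<Longrightarrow> \<exists>\<V>. decomposition_chain X N R \<V>"
    using X unfolding countable_asymptotic_dimension_iff_chain by blast
  obtain R\<^sub>0 where R\<^sub>0: "R\<^sub>0 > 0" and Y_sub: "Y \<subseteq> metric_nbhd Y (f ` X) R\<^sub>0"
    using surj unfolding coarsely_surjective_def by blast
  have cover: "\<exists>x\<in>X. dist y (f x) < R\<^sub>0" if "y \<in> Y" for y
    using that Y_sub R\<^sub>0 unfolding metric_nbhd_def by force
  show ?thesis
    unfolding countable_asymptotic_dimension_iff_chain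
  proof (intro exI[of _ "\<lambda>i. N i * n"] conjI allI impI)
    fix i :: nat assume "1 \<le> i"
    then show "1 \<le> N i * n" using n N[of i] by simp
  next
    fix R :: "nat \<Rightarrow> real" assume R: "\<forall>i\<ge>1. 0 < R i"
    \<comment> \<open>The empty sum gives \<open>r 1 = R\<^sub>0\<close>, the radius of coarse
      surjectivity, and each level adds the \<open>n * R i\<close> by which one decomposition
      enlarges neighbourhoods. The radii depend on \<open>R\<close> and \<open>R\<^sub>0\<close>
      alone, so they are known before the chain on \<open>X\<close> is chosen.\<close>
    define r where "r i = R\<^sub>0 + (\<Sum>k\<in>{1..<i}. real n * R k)" for i
    have r0: "0 < r i" for i
      unfolding r_def using R R\<^sub>0 by (intro add_pos_nonneg sum_nonneg) (auto simp: less_imp_le)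
    have r_Suc: "r (i + 1) = r i + real n * R i" if "i \<ge> 1" for i
      using that by (simp add: r_def)
    have "0 \<le> D (2 * r i)" for i
      using D less_imp_le[OF r0[of i]]
      unfolding coarsely_n_to_1_with_def control_function_def by simp
    \<comment> \<open>Decomposing level \<open>i\<close> counts near members at radius
      \<open>r (i + 1)\<close>, hence in balls of diameter at most \<open>2 * r (i + 1)\<close>. The
      summand 1 ensures positivity.\<close>
    then have "\<forall>i\<ge>1. 0 < D (2 * r (i + 1)) + 1"
      by (simp add: add_nonneg_pos)
    from ex[OF this] obtain \<V> where "decomposition_chain X N (\<lambda>i. D (2 * r (i + 1)) + 1) \<V>" by blast
    then obtain m where sub: "\<And>i U. i \<ge> 1 \<Longrightarrow> U \<in> \<V> i \<Longrightarrow> U \<subseteq> X"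
      and V1: "\<V> 1 = {X}"
      and dec: "\<And>i U. i \<ge> 1 \<Longrightarrow> U \<in> \<V> i \<Longrightarrow>
        union_of_R_disjoint_families U (N i) (D (2 * r (i + 1)) + 1) (\<V> (i + 1))"
      and m: "m \<ge> 1" "uniformly_bounded (\<V> m)"
      by (rule decomposition_chainE) blast
    \<comment> \<open>The chain must start with exactly \<open>{Y}\<close>, whereas
      \<open>image_nbhd_sets\<close> would contain all subsets of \<open>Y\<close> there.\<close>
    define \<W> where "\<W> i = (if i = 1 then {Y} else image_nbhd_sets f Y (\<V> i) (r i))" for i
    \<comment> \<open>At \<open>i = 1\<close> this is coarse surjectivity. Level 1 then needs no
      separate treatment in the decomposition or in the bound at \<open>m\<close>, which may be
      1.\<close>
    have \<W>_sub: "\<W> i \<subseteq> image_nbhd_sets f Y (\<V> i) (r i)" for i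
      using cover V1 by (auto simp: \<W>_def image_nbhd_sets_def r_def)
    have "A \<subseteq> Y" if "A \<in> \<W> i" for i A
      using that \<W>_sub unfolding image_nbhd_sets_def by blast
    moreover have "\<W> 1 = {Y}" by (simp add: \<W>_def)
    moreover have "union_of_R_disjoint_families A (N i * n) (R i) (\<W> (i + 1))"
      if i: "i \<ge> 1" and A: "A \<in> \<W> i" for i A
    proof -
      have "A \<in> image_nbhd_sets f Y (\<V> i) (r i)"
        using A \<W>_sub[of i] by (rule rev_subsetD)
      then obtain U where U: "U \<in> \<V> i" "A \<subseteq> Y" "\<And>a. a \<in> A \<Longrightarrow> \<exists>u\<in>U. dist a (f u) < r i"
        unfolding image_nbhd_sets_def by blast
      have "union_of_R_disjoint_families A (N i * n) (R i)
          (image_nbhd_sets f Y (\<V> (i + 1)) (r i + real n * R i))"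
        using sub[of "i + 1"] R i less_imp_le[OF r0] r_Suc[OF i]
        by (intro union_of_R_disjoint_families_image_nbhd_sets[OF f D _ dec[OF i U(1)] U(2,3)])
          auto
      then show ?thesis using i r_Suc[OF i] by (simp add: \<W>_def)
    qed
    moreover have "uniformly_bounded (\<W> m)"
      using uniformly_bounded_image_nbhd_sets[OF E sub[OF m(1)] m(2) less_imp_le[OF r0]] \<W>_sub
      by (rule uniformly_bounded_subset)
    ultimately show "\<exists>\<V>. decomposition_chain Y (\<lambda>i. N i * n) R \<V>"
      using m(1) by (intro exI[of _ \<W>] decomposition_chainI[of \<W> _ _ _ m]) simp_all
  qed
qed

theorem theorem8p7:
  fixes X :: "'a::metric_space set" and Y :: "'b::metric_space set"
    and f :: "'a \<Rightarrow> 'b" and E D :: "real \<Rightarrow> real" and n :: nat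
  assumes "n \<ge> 1"
    and "f \<in> X \<rightarrow> Y"
    and "bornologous_with X f E"
    and "coarsely_n_to_1_with n X Y f D"
    and "coarsely_surjective X Y f"
  shows "countable_asymptotic_dimension Y \<longleftrightarrow> countable_asymptotic_dimension X"
  using countable_asymptotic_dimension_vimage[OF assms(1-4)]
    countable_asymptotic_dimension_coarse_image[OF assms] by blast

end
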